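(* The Dual-minus star order $\overset{{\rm DM}\text{-}\ast}{\leq}$ is a partial order (reflexive, antisymmetric and transitive) on the set of all dual matrices in $\mathbb{D}^{m\times n}$ whose dual Moore-Penrose generalized inverse (DMPGI) exists.
   Context: $\varepsilon$ is the dual unit: $\varepsilon\neq 0$, $\varepsilon^2=0$, commuting with reals. $\mathbb{D}^{m\times n}$ is the set of $m\times n$ dual matrices $\widehat E=E+\varepsilon E_0$ with $E,E_0\in\mathbb{R}^{m\times n}$, with the obvious addition, multiplication and transpose $\widehat E^{T}=E^T+\varepsilon E_0^T$. The DMPGI of $\widehat E\in\mathbb{D}^{m\times n}$ is the unique $\widehat X\in\mathbb{D}^{n\times m}$, if it exists, with $\widehat E\widehat X\widehat E=\widehat E$, $\widehat X\widehat E\widehat X=\widehat X$, $(\widehat E\widehat X)^T=\widehat E\widehat X$, $(\widehat X\widehat E)^T=\widehat X\widehat E$. Star partial order on real $m\times n$ matrices: $E\overset{\ast}{\leq}F$ means $E^{T}E=E^{T}F$ and $EE^{T}=FE^{T}$. Dual-minus star order: for $\widehat E=E+\varepsilon E_0,\widehat F=F+\varepsilon F_0\in\mathbb{D}^{m\times n}$ whose DMPGIs exist, $\widehat E\overset{{\rm DM}\text{-}\ast}{\leq}\widehat F$ means that $E\overset{\ast}{\leq}F$ and the DMPGI of $\widehat F-\widehat E$ exists. *)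

theory Defs
  imports "HOL-Analysis.Analysis"
begin

text \<open>Dual numbers \<open>a + \<epsilon> b\<close> over the reals, with \<open>\<epsilon>\<^sup>2 = 0\<close>.\<close>

datatype dual = Dual (std_part: real) (dual_part: real)

instantiation dual :: comm_ring_1
begin

definition "0 = Dual 0 0"
definition "1 = Dual 1 0"
definition "x + y = Dual (std_part x + std_part y) (dual_part x + dual_part y)"
definition "- x = Dual (- std_part x) (- dual_part x)"
definition "x - y = Dual (std_part x - std_part y) (dual_part x - dual_part y)"
definition "x * y = Dual (std_part x * std_part y)
                         (std_part x * dual_part y + dual_part x * std_part y)"

instance
  by standard
    (simp_all add: zero_dual_def one_dual_def plus_dual_def uminus_dual_def
      minus_dual_def times_dual_def algebra_simps)

end

definition dual_eps :: dual where
  "dual_eps = Dual 0 1"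

lemma dual_eps_nonzero: "dual_eps \<noteq> 0"
  by (simp add: dual_eps_def zero_dual_def)

lemma dual_eps_square: "dual_eps * dual_eps = 0"
  by (simp add: dual_eps_def zero_dual_def times_dual_def)

lemma Dual_eq_eps: "Dual a b = Dual a 0 + dual_eps * Dual b 0"
  by (simp add: dual_eps_def plus_dual_def times_dual_def)

lemma std_part_simps [simp]:
  "std_part 0 = 0" "std_part 1 = 1" "std_part (x + y) = std_part x + std_part y"
  "std_part (- x) = - std_part x" "std_part (x - y) = std_part x - std_part y"
  "std_part (x * y) = std_part x * std_part y"
  by (simp_all add: zero_dual_def one_dual_def plus_dual_def uminus_dual_def
      minus_dual_def times_dual_def)

lemma dual_part_simps [simp]:
  "dual_part 0 = 0" "dual_part 1 = 0" "dual_part (x + y) = dual_part x + dual_part y"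
  "dual_part (- x) = - dual_part x" "dual_part (x - y) = dual_part x - dual_part y"
  "dual_part (x * y) = std_part x * dual_part y + dual_part x * std_part y"
  by (simp_all add: zero_dual_def one_dual_def plus_dual_def uminus_dual_def
      minus_dual_def times_dual_def)

lemma std_part_sum [simp]: "std_part (sum f A) = (\<Sum>x\<in>A. std_part (f x))"
  by (induction A rule: infinite_finite_induct) simp_all

lemma dual_part_sum [simp]: "dual_part (sum f A) = (\<Sum>x\<in>A. dual_part (f x))"
  by (induction A rule: infinite_finite_induct) simp_all


text \<open>
  Matrices with dual entries are the library's \<^typ>\<open>dual ^ 'n ^ 'm\<close>, with its \<open>+\<close>, \<open>-\<close>,
  \<open>**\<close> and \<^const>\<open>transpose\<close>.  The matrix \<open>E + \<epsilon> E\<^sub>0\<close> is \<open>dual_mat E E\<^sub>0\<close>; the lemmas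
  below confirm that the entrywise operations are the usual ones on such expressions.
\<close>

definition dual_mat :: "real ^ 'n ^ 'm \<Rightarrow> real ^ 'n ^ 'm \<Rightarrow> dual ^ 'n ^ 'm" where
  "dual_mat E E0 = (\<chi> i j. Dual (E $ i $ j) (E0 $ i $ j))"

definition std_mat :: "dual ^ 'n ^ 'm \<Rightarrow> real ^ 'n ^ 'm" where
  "std_mat A = (\<chi> i j. std_part (A $ i $ j))"

definition inf_mat :: "dual ^ 'n ^ 'm \<Rightarrow> real ^ 'n ^ 'm" where
  "inf_mat A = (\<chi> i j. dual_part (A $ i $ j))"

lemma dual_mat_parts [simp]: "dual_mat (std_mat A) (inf_mat A) = A"
  by (simp add: dual_mat_def std_mat_def inf_mat_def vec_eq_iff)

lemma std_mat_dual_mat [simp]: "std_mat (dual_mat E E0) = E"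
  by (simp add: dual_mat_def std_mat_def vec_eq_iff)

lemma inf_mat_dual_mat [simp]: "inf_mat (dual_mat E E0) = E0"
  by (simp add: dual_mat_def inf_mat_def vec_eq_iff)

lemma dual_mat_add: "dual_mat E E0 + dual_mat F F0 = dual_mat (E + F) (E0 + F0)"
  by (simp add: dual_mat_def vec_eq_iff plus_dual_def)

lemma dual_mat_diff: "dual_mat E E0 - dual_mat F F0 = dual_mat (E - F) (E0 - F0)"
  by (simp add: dual_mat_def vec_eq_iff minus_dual_def)

lemma dual_mat_mult:
  "dual_mat E E0 ** dual_mat F F0 = dual_mat (E ** F) (E ** F0 + E0 ** F)"
  by (simp add: dual_mat_def matrix_matrix_mult_def vec_eq_iff dual.expand sum.distrib)

lemma dual_mat_transpose: "transpose (dual_mat E E0) = dual_mat (transpose E) (transpose E0)"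
  by (simp add: dual_mat_def transpose_def vec_eq_iff)


definition is_dmpgi :: "dual ^ 'n ^ 'm \<Rightarrow> dual ^ 'm ^ 'n \<Rightarrow> bool" where
  "is_dmpgi E X \<longleftrightarrow>
     E ** X ** E = E \<and> X ** E ** X = X \<and>
     transpose (E ** X) = E ** X \<and> transpose (X ** E) = X ** E"

lemma is_dmpgi_unique:
  assumes "is_dmpgi E X" "is_dmpgi E Y"
  shows "X = Y"
proof -
  have X: "E ** X ** E = E" "X ** E ** X = X" "transpose (E ** X) = E ** X"
      "transpose (X ** E) = X ** E"
    and Y: "E ** Y ** E = E" "Y ** E ** Y = Y" "transpose (E ** Y) = E ** Y"
      "transpose (Y ** E) = Y ** E"
    using assms by (auto simp: is_dmpgi_def)
  have "E ** X = transpose (E ** Y ** E ** X)"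
    using X(3) Y(1) by simp
  also have "\<dots> = transpose (E ** X) ** transpose (E ** Y)"
    by (simp add: matrix_transpose_mul matrix_mul_assoc)
  also have "\<dots> = E ** Y"
    by (simp add: X Y matrix_mul_assoc)
  finally have EX: "E ** X = E ** Y" .
  have "X ** E = transpose (X ** (E ** Y ** E))"
    using X(4) Y(1) by simp
  also have "\<dots> = transpose (Y ** E) ** transpose (X ** E)"
    by (simp add: matrix_transpose_mul matrix_mul_assoc)
  also have "\<dots> = Y ** (E ** X ** E)"
    unfolding X(4) Y(4) by (simp add: matrix_mul_assoc)
  also have "\<dots> = Y ** E"
    by (simp add: X)
  finally have XE: "X ** E = Y ** E" .
  have "X = X ** E ** X" by (simp add: X)
  also have "\<dots> = Y ** (E ** X)" by (simp add: XE matrix_mul_assoc)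
  also have "\<dots> = Y" by (simp add: EX Y matrix_mul_assoc)
  finally show ?thesis .
qed

text \<open>Uniqueness being automatic (\<open>is_dmpgi_unique\<close>), the DMPGI exists iff some solution does.\<close>

definition has_dmpgi :: "dual ^ 'n ^ 'm \<Rightarrow> bool" where
  "has_dmpgi E \<longleftrightarrow> (\<exists>X. is_dmpgi E X)"

definition star_le :: "real ^ 'n ^ 'm \<Rightarrow> real ^ 'n ^ 'm \<Rightarrow> bool" where
  "star_le E F \<longleftrightarrow>
     transpose E ** E = transpose E ** F \<and> E ** transpose E = F ** transpose E"

text \<open>Meaningful only for \<open>E\<close>, \<open>F\<close> satisfying \<^const>\<open>has_dmpgi\<close>.\<close>

definition dm_star_le :: "dual ^ 'n ^ 'm \<Rightarrow> dual ^ 'n ^ 'm \<Rightarrow> bool" where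
  "dm_star_le E F \<longleftrightarrow> star_le (std_mat E) (std_mat F) \<and> has_dmpgi (F - E)"

end

(* E + \<epsilon> E0 has a DMPGI iff y^T E0 x = 0 for all x in ker E and y in ker E^T.  Along a chain
   E \<le> F \<le> G the real parts of F - E and G - F are star-orthogonal, so the kernel of their sum
   is the intersection of their kernels, and likewise for the transposes.  Hence the condition
   passes from F - E and G - F to their sum G - E. *)
theory Submission
  imports Defs
begin

section \<open>Matrix algebra over rings\<close>

lemma matrix_mul_zero_left: "(0 :: 'a::semiring_1 ^ 'n ^ 'm) ** A = 0"
  by (simp add: matrix_matrix_mult_def vec_eq_iff)

lemma matrix_mul_zero_right: "A ** (0 :: 'a::semiring_1 ^ 'n ^ 'm) = 0"
  by (simp add: matrix_matrix_mult_def vec_eq_iff)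

lemma matrix_add_rdistrib: "(A + B) ** C = A ** C + B ** (C :: 'a::semiring_1 ^ 'n ^ 'm)"
  by (simp add: matrix_matrix_mult_def vec_eq_iff sum.distrib distrib_right)

lemma matrix_diff_ldistrib: "A ** (B - C) = A ** B - A ** (C :: 'a::ring_1 ^ 'n ^ 'm)"
  by (simp add: matrix_matrix_mult_def vec_eq_iff sum_subtractf right_diff_distrib)

lemma matrix_diff_rdistrib: "(A - B) ** C = A ** C - B ** (C :: 'a::ring_1 ^ 'n ^ 'm)"
  by (simp add: matrix_matrix_mult_def vec_eq_iff sum_subtractf left_diff_distrib)

lemma transpose_zero: "transpose 0 = (0 :: 'a::zero ^ 'n ^ 'm)"
  by (simp add: transpose_def vec_eq_iff)

lemma transpose_add: "transpose (A + B) = transpose A + transpose (B :: 'a::plus ^ 'n ^ 'm)"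
  by (simp add: transpose_def vec_eq_iff)

lemma transpose_diff: "transpose (A - B) = transpose A - transpose (B :: 'a::minus ^ 'n ^ 'm)"
  by (simp add: transpose_def vec_eq_iff)

lemmas matrix_ring_simps =
  matrix_mul_zero_left matrix_mul_zero_right
  matrix_add_ldistrib matrix_add_rdistrib matrix_diff_ldistrib matrix_diff_rdistrib

text \<open>Lets a known product \<open>A ** B\<close> be rewritten inside right-nested products,
  where it does not occur as a subterm.\<close>

lemma matrix_mul_assoc_subst:
  assumes "A ** B = C"
  shows "A ** (B ** Z) = C ** (Z :: 'a::semiring_1 ^ 'n ^ 'm)"
  by (metis assms matrix_mul_assoc)

section \<open>Existence criterion for the DMPGI\<close>

text \<open>The Penrose equations of \<open>is_dmpgi\<close> over an arbitrary commutative ring, so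
  that they apply to real standard parts.\<close>

definition is_mp_inverse :: "'a::comm_ring_1 ^ 'n ^ 'm \<Rightarrow> 'a ^ 'm ^ 'n \<Rightarrow> bool" where
  "is_mp_inverse E X \<longleftrightarrow>
     E ** X ** E = E \<and> X ** E ** X = X \<and>
     transpose (E ** X) = E ** X \<and> transpose (X ** E) = X ** E"

text \<open>
  If \<open>P\<close> is the Moore-Penrose inverse of \<open>E\<close>, the condition below says that \<open>E\<^sub>0\<close> induces the
  zero form on \<open>ker E\<^sup>T \<times> ker E\<close>.
\<close>
lemma has_dmpgi_dual_mat_iff:
  "has_dmpgi (dual_mat E E0) \<longleftrightarrow>
     (\<exists>P. is_mp_inverse E P \<and> (mat 1 - E ** P) ** E0 ** (mat 1 - P ** E) = 0)"
proof
  assume "has_dmpgi (dual_mat E E0)"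
  then obtain X where "is_dmpgi (dual_mat E E0) X"
    by (auto simp: has_dmpgi_def)
  then obtain P P0 where X: "is_dmpgi (dual_mat E E0) (dual_mat P P0)"
    by (metis dual_mat_parts)
  have P: "is_mp_inverse E P"
    using X unfolding is_dmpgi_def is_mp_inverse_def
    by (metis dual_mat_mult dual_mat_transpose std_mat_dual_mat)
  \<comment> \<open>Infinitesimal parts of the first Penrose equation write \<open>E0\<close> as a
    sum whose terms all have \<open>E\<close> as leftmost or rightmost factor; the complementary
    projections annihilate each of them.\<close>
  have "inf_mat (dual_mat E E0 ** dual_mat P P0 ** dual_mat E E0) = E0"
    using X by (simp add: is_dmpgi_def)
  then have E0: "E0 = E ** P ** E0 + (E ** P0 + E0 ** P) ** E"
    by (simp add: dual_mat_mult)
  have l: "(mat 1 - E ** P) ** E = 0" and r: "E ** (mat 1 - P ** E) = 0"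
    using P by (simp_all add: is_mp_inverse_def matrix_ring_simps matrix_mul_assoc)
  have "(mat 1 - E ** P) ** E0 ** (mat 1 - P ** E) =
    (mat 1 - E ** P) ** (E ** P ** E0 + (E ** P0 + E0 ** P) ** E) ** (mat 1 - P ** E)"
    using E0 by simp
  also have "\<dots> = ((mat 1 - E ** P) ** E) ** (P ** E0 + P0 ** E) ** (mat 1 - P ** E)
      + (mat 1 - E ** P) ** E0 ** P ** (E ** (mat 1 - P ** E))"
    by (simp only: matrix_add_ldistrib matrix_add_rdistrib matrix_mul_assoc add_ac)
  also have "\<dots> = 0"
    by (simp only: l r matrix_mul_zero_left matrix_mul_zero_right add_0)
  finally show "\<exists>P. is_mp_inverse E P \<and> (mat 1 - E ** P) ** E0 ** (mat 1 - P ** E) = 0"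
    using P by blast
next
  assume "\<exists>P. is_mp_inverse E P \<and> (mat 1 - E ** P) ** E0 ** (mat 1 - P ** E) = 0"
  then obtain P where P: "is_mp_inverse E P"
    and C: "(mat 1 - E ** P) ** E0 ** (mat 1 - P ** E) = 0" by blast
  note mp = P[unfolded is_mp_inverse_def]
  define L where "L = mat 1 - E ** P"
  define R where "R = mat 1 - P ** E"
  have LE: "L ** E = 0" and PL: "P ** L = 0" and ER: "E ** R = 0" and RP: "R ** P = 0"
    using mp by (simp_all add: L_def R_def matrix_ring_simps matrix_mul_assoc)
  \<comment> \<open>This and the next identity are transposes of \<open>P ** E ** P = P\<close>,
    using the symmetry of \<open>E ** P\<close> and of \<open>P ** E\<close> respectively.\<close>
  have EPPt: "E ** P ** transpose P = transpose P"
    using mp by (metis matrix_transpose_mul matrix_mul_assoc)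
  have PtPE: "transpose P ** P ** E = transpose P"
    using mp by (metis matrix_transpose_mul matrix_mul_assoc)
  have tL: "transpose L = L" and tR: "transpose R = R"
    using mp by (simp_all add: L_def R_def transpose_diff)
  have LCR: "L ** E0 ** R = 0" using C by (simp add: L_def R_def)
  \<comment> \<open>the derivative of the Moore-Penrose inverse along a constant-rank curve (Golub-Pereyra)\<close>
  define P0 where "P0 = P ** transpose P ** transpose E0 ** L
    + R ** transpose E0 ** transpose P ** P - P ** E0 ** P"
  \<comment> \<open>The form M plus its transpose, here and in \<open>XE\<close>, is visibly
    symmetric, which settles the infinitesimal parts of the last two Penrose equations.\<close>
  have EX: "E ** P0 + E0 ** P = L ** E0 ** P + transpose (L ** E0 ** P)"
  proof -
    have "E ** P0 = (E ** P ** transpose P) ** transpose E0 ** L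
      + (E ** R) ** transpose E0 ** transpose P ** P - E ** P ** E0 ** P"
      by (simp add: P0_def matrix_ring_simps matrix_mul_assoc)
    also have "\<dots> = transpose (L ** E0 ** P) - E ** P ** E0 ** P"
      by (simp add: EPPt ER tL matrix_ring_simps matrix_transpose_mul matrix_mul_assoc)
    finally show ?thesis
      by (simp add: L_def matrix_ring_simps matrix_mul_assoc)
  qed
  have XE: "P ** E0 + P0 ** E = P ** E0 ** R + transpose (P ** E0 ** R)"
  proof -
    have "P0 ** E = P ** transpose P ** transpose E0 ** (L ** E)
      + R ** transpose E0 ** (transpose P ** P ** E) - P ** E0 ** P ** E"
      by (simp add: P0_def matrix_ring_simps matrix_mul_assoc)
    also have "\<dots> = transpose (P ** E0 ** R) - P ** E0 ** P ** E"
      by (simp add: PtPE LE tR matrix_ring_simps matrix_transpose_mul matrix_mul_assoc)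
    finally show ?thesis
      by (simp add: R_def matrix_ring_simps matrix_mul_assoc)
  qed
  have EXE: "E ** P ** E0 + (E ** P0 + E0 ** P) ** E = E0"
  proof -
    have "(E ** P0 + E0 ** P) ** E = L ** E0 ** P ** E + transpose P ** transpose E0 ** (L ** E)"
      by (simp add: EX tL matrix_ring_simps matrix_transpose_mul matrix_mul_assoc)
    \<comment> \<open>By \<open>P ** E = mat 1 - R\<close>. The term \<open>L ** E0 ** R\<close>
      that appears is exactly the one the criterion makes vanish.\<close>
    also have "\<dots> = L ** E0 - L ** E0 ** R"
      by (simp add: LE R_def matrix_ring_simps matrix_mul_assoc)
    finally show ?thesis
      by (simp add: LCR) (simp add: L_def matrix_ring_simps matrix_mul_assoc)
  qed
  have XEX: "P ** E ** P0 + (P ** E0 + P0 ** E) ** P = P0"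
  proof -
    have "P ** E ** P0 = (P ** E ** P) ** transpose P ** transpose E0 ** L
      + P ** (E ** R) ** transpose E0 ** transpose P ** P - (P ** E ** P) ** E0 ** P"
      by (simp add: P0_def matrix_ring_simps matrix_mul_assoc)
    moreover have "(P ** E0 + P0 ** E) ** P =
      P ** E0 ** (R ** P) + R ** transpose E0 ** transpose P ** P"
      by (simp add: XE tR matrix_ring_simps matrix_transpose_mul matrix_mul_assoc)
    ultimately show ?thesis
      using mp by (simp add: RP ER P0_def matrix_ring_simps)
  qed
  have "is_dmpgi (dual_mat E E0) (dual_mat P P0)"
    unfolding is_dmpgi_def dual_mat_mult dual_mat_transpose EXE XEX
    unfolding EX XE transpose_add transpose_transpose
    using mp by (simp add: add.commute)
  then show "has_dmpgi (dual_mat E E0)"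
    by (auto simp: has_dmpgi_def)
qed

section \<open>Sums of star-orthogonal matrices\<close>

text \<open>Symmetry of \<open>A ** P\<close> gives
  \<open>P = P ** transpose P ** transpose A\<close>, so \<open>P\<close> inherits the left
  annihilation from \<open>transpose A\<close>. The next lemma is the mirror image.\<close>

lemma is_mp_inverse_mul_eq_0:
  assumes "is_mp_inverse A P" and "transpose A ** B = 0"
  shows "P ** B = 0"
proof -
  have "P ** B = P ** transpose (A ** P) ** B"
    using assms(1) by (simp add: is_mp_inverse_def matrix_mul_assoc)
  also have "\<dots> = P ** transpose P ** (transpose A ** B)"
    by (simp add: matrix_transpose_mul matrix_mul_assoc)
  finally show ?thesis
    by (simp add: assms(2) matrix_mul_zero_right)
qed

lemma is_mp_inverse_mul_eq_0':
  assumes "is_mp_inverse A P" and "B ** transpose A = 0"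
  shows "B ** P = 0"
proof -
  have "B ** P = B ** transpose (P ** A) ** P"
    using assms(1) by (simp add: is_mp_inverse_def flip: matrix_mul_assoc)
  also have "\<dots> = (B ** transpose A) ** transpose P ** P"
    by (simp add: matrix_transpose_mul matrix_mul_assoc)
  finally show ?thesis
    by (simp add: assms(2) matrix_mul_zero_left)
qed

context
  fixes A B :: "'a::comm_ring_1 ^ 'n ^ 'm" and P Q
  assumes P: "is_mp_inverse A P" and Q: "is_mp_inverse B Q"
    and AtB: "transpose A ** B = 0" and ABt: "A ** transpose B = 0"
begin

lemma star_orthogonal_mp_inverse:
  "P ** B = 0" "Q ** A = 0" "A ** Q = 0" "B ** P = 0"
proof -
  have "transpose B ** A = 0" "B ** transpose A = 0"
    using AtB ABt by (metis matrix_transpose_mul transpose_transpose transpose_zero)+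
  then show "P ** B = 0" "Q ** A = 0" "A ** Q = 0" "B ** P = 0"
    using P Q AtB ABt is_mp_inverse_mul_eq_0 is_mp_inverse_mul_eq_0' by blast+
qed

lemma star_orthogonal_mul_add:
  "(A + B) ** (P + Q) = A ** P + B ** Q" "(P + Q) ** (A + B) = P ** A + Q ** B"
  by (simp_all add: star_orthogonal_mp_inverse matrix_ring_simps)

text \<open>All cross products of \<open>A\<close>, \<open>B\<close> with \<open>Q\<close>,
  \<open>P\<close> vanish, so the Penrose equations for the sum split into those for the two
  summands.\<close>

lemma is_mp_inverse_add: "is_mp_inverse (A + B) (P + Q)"
  unfolding is_mp_inverse_def star_orthogonal_mul_add
  using P Q
  by (simp add: is_mp_inverse_def star_orthogonal_mp_inverse matrix_ring_simps transpose_add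
      flip: matrix_mul_assoc)

text \<open>The vanishing cross products make the complementary projections of \<open>A\<close> and
  \<open>B\<close> commute, and their product projects onto the intersection of the kernels. Both
  orders are recorded so that either factor can be placed innermost.\<close>

lemma complementary_projections_add:
  "mat 1 - (A + B) ** (P + Q) = (mat 1 - B ** Q) ** (mat 1 - A ** P)"
  "mat 1 - (A + B) ** (P + Q) = (mat 1 - A ** P) ** (mat 1 - B ** Q)"
  "mat 1 - (P + Q) ** (A + B) = (mat 1 - P ** A) ** (mat 1 - Q ** B)"
  "mat 1 - (P + Q) ** (A + B) = (mat 1 - Q ** B) ** (mat 1 - P ** A)"
  unfolding star_orthogonal_mul_add
  by (simp_all add: star_orthogonal_mp_inverse[THEN matrix_mul_assoc_subst] matrix_ring_simps
      flip: matrix_mul_assoc)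

end

lemma has_dmpgi_add:
  assumes "has_dmpgi A" "has_dmpgi B"
    and orth: "transpose (std_mat A) ** std_mat B = 0" "std_mat A ** transpose (std_mat B) = 0"
  shows "has_dmpgi (A + B)"
proof -
  define S T S0 T0 where "S = std_mat A" "T = std_mat B" "S0 = inf_mat A" "T0 = inf_mat B"
  note defs = this
  have A: "A = dual_mat S S0" and B: "B = dual_mat T T0"
    by (simp_all add: defs)
  obtain P where P: "is_mp_inverse S P"
    and S0: "(mat 1 - S ** P) ** S0 ** (mat 1 - P ** S) = 0"
    using assms(1) unfolding A has_dmpgi_dual_mat_iff by blast
  obtain Q where Q: "is_mp_inverse T Q"
    and T0: "(mat 1 - T ** Q) ** T0 ** (mat 1 - Q ** T) = 0"
    using assms(2) unfolding B has_dmpgi_dual_mat_iff by blast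
  have orth': "transpose S ** T = 0" "S ** transpose T = 0"
    using orth by (simp_all add: defs)
  note proj = complementary_projections_add[OF P Q orth']
  let ?L = "mat 1 - (S + T) ** (P + Q)" and ?R = "mat 1 - (P + Q) ** (S + T)"
  \<comment> \<open>The order of the factors puts the projections of \<open>S\<close> next to
    \<open>S0\<close>; for \<open>T0\<close> below the opposite order is chosen.\<close>
  have "?L ** S0 ** ?R =
    (mat 1 - T ** Q) ** ((mat 1 - S ** P) ** S0 ** (mat 1 - P ** S)) ** (mat 1 - Q ** T)"
    unfolding proj(1,3) by (simp only: matrix_mul_assoc)
  moreover have "?L ** T0 ** ?R =
    (mat 1 - S ** P) ** ((mat 1 - T ** Q) ** T0 ** (mat 1 - Q ** T)) ** (mat 1 - P ** S)"
    unfolding proj(2,4) by (simp only: matrix_mul_assoc)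
  ultimately have "?L ** (S0 + T0) ** ?R = 0"
    unfolding S0 T0 matrix_add_ldistrib matrix_add_rdistrib
    by (simp add: matrix_mul_zero_left matrix_mul_zero_right)
  then show ?thesis
    unfolding A B dual_mat_add has_dmpgi_dual_mat_iff
    using is_mp_inverse_add[OF P Q orth'] by blast
qed

section \<open>The star order on real matrices\<close>

lemma star_le_transpose:
  "star_le E F \<Longrightarrow> transpose E ** E = transpose F ** E \<and> E ** transpose E = E ** transpose F"
  unfolding star_le_def by (metis matrix_transpose_mul transpose_transpose)

text \<open>The diagonal of \<open>transpose A ** A\<close> consists of the squared norms of the
  columns of \<open>A\<close>.\<close>

lemma matrix_transpose_mul_self_eq_0:
  fixes A :: "real ^ 'n ^ 'm"
  assumes "transpose A ** A = 0"
  shows "A = 0"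
proof -
  have "column j A = 0" for j
  proof -
    have "(transpose A ** A) $ j $ j = 0" using assms by simp
    then show ?thesis by (simp add: matrix_mult_transpose_dot_column)
  qed
  then show ?thesis by (simp add: column_def vec_eq_iff)
qed

lemma star_le_antisym:
  assumes "star_le E F" "star_le F E"
  shows "E = F"
proof -
  have "transpose (F - E) ** (F - E) = 0"
    using assms star_le_transpose[OF assms(1)]
    by (simp add: star_le_def transpose_diff matrix_ring_simps)
  then show ?thesis
    using matrix_transpose_mul_self_eq_0 by force
qed

text \<open>\<open>E = E P E\<close> turns \<open>E E\<^sup>T = F E\<^sup>T\<close> and \<open>E\<^sup>T E = E\<^sup>T F\<close> into factorizations of \<open>E\<close> through \<open>F\<close>
  from the left and from the right.\<close>
lemma star_le_trans:
  assumes P: "is_mp_inverse E P" and EF: "star_le E F" and FG: "star_le F G"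
  shows "star_le E G"
proof -
  note ef = EF[unfolded star_le_def] star_le_transpose[OF EF]
  note fg = FG[unfolded star_le_def] star_le_transpose[OF FG]
  have "transpose E = transpose (E ** transpose (P ** E))"
    using P by (simp add: is_mp_inverse_def matrix_mul_assoc)
  also have "\<dots> = P ** (E ** transpose E)"
    by (simp add: matrix_transpose_mul matrix_mul_assoc)
  also have "E ** transpose E = E ** transpose F"
    using ef by simp
  finally have l: "transpose E = P ** E ** transpose F"
    by (simp add: matrix_mul_assoc)
  have "transpose E = transpose (transpose (E ** P) ** E)"
    using P by (simp add: is_mp_inverse_def)
  also have "\<dots> = transpose E ** E ** P"
    by (simp add: matrix_transpose_mul matrix_mul_assoc)
  finally have r: "transpose E = transpose F ** E ** P"
    using ef by simp
  have "transpose E ** G = transpose E ** F"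
    unfolding l using fg by (simp flip: matrix_mul_assoc)
  moreover have "G ** transpose E = F ** transpose E"
    unfolding r using fg by (simp add: matrix_mul_assoc)
  ultimately show ?thesis
    using ef by (simp add: star_le_def)
qed

text \<open>After expansion the terms without \<open>E\<close> cancel by \<open>FG\<close>, while
  those with \<open>E\<close> all reduce to \<open>transpose E ** E\<close>, or
  \<open>E ** transpose E\<close>, by \<open>EF\<close> and \<open>EG\<close>.\<close>

lemma star_le_diff_orthogonal:
  assumes EF: "star_le E F" and FG: "star_le F G" and EG: "star_le E G"
  shows "transpose (F - E) ** (G - F) = 0" "(F - E) ** transpose (G - F) = 0"
  using assms star_le_transpose[OF EF] star_le_transpose[OF FG] star_le_transpose[OF EG]
  by (simp_all add: star_le_def transpose_diff matrix_ring_simps)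

section \<open>The dual-minus star order\<close>

lemma std_mat_diff: "std_mat (A - B) = std_mat A - std_mat B"
  by (simp add: std_mat_def vec_eq_iff)

lemma dm_star_le_refl: "dm_star_le E E"
proof -
  have "is_dmpgi (0 :: dual ^ 'n ^ 'm) 0"
    by (simp add: is_dmpgi_def matrix_mul_zero_left transpose_zero)
  then show ?thesis
    by (auto simp: dm_star_le_def has_dmpgi_def star_le_def)
qed

text \<open>A purely infinitesimal \<open>\<epsilon> D\<close> has a DMPGI only if \<open>D = 0\<close>.\<close>
lemma dm_star_le_antisym:
  assumes "dm_star_le E F" "dm_star_le F E"
  shows "E = F"
proof -
  have std: "std_mat E = std_mat F"
    using assms star_le_antisym by (auto simp: dm_star_le_def)
  obtain D where D: "F - E = dual_mat 0 D"
    by (metis dual_mat_parts std std_mat_diff cancel_comm_monoid_add_class.diff_cancel)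
  then have "has_dmpgi (dual_mat 0 D)"
    using assms(1) by (simp add: dm_star_le_def)
  \<comment> \<open>For standard part 0 both complementary projections are the identity, so the
    criterion itself reads \<open>D = 0\<close>.\<close>
  then have "D = 0"
    unfolding has_dmpgi_dual_mat_iff
    by (simp add: matrix_mul_zero_left matrix_mul_zero_right)
  then have "F - E = 0"
    by (simp add: D dual_mat_def vec_eq_iff zero_dual_def)
  then show ?thesis by simp
qed

lemma dm_star_le_trans:
  assumes "has_dmpgi E" "dm_star_le E F" "dm_star_le F G"
  shows "dm_star_le E G"
proof -
  have EF: "star_le (std_mat E) (std_mat F)" and FG: "star_le (std_mat F) (std_mat G)"
    using assms by (simp_all add: dm_star_le_def)
  \<comment> \<open>The DMPGI of \<open>E\<close> supplies the real Moore-Penrose inverse on which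
    \<open>star_le_trans\<close> relies.\<close>
  obtain P where "is_mp_inverse (std_mat E) P"
    using assms(1) has_dmpgi_dual_mat_iff by (metis dual_mat_parts)
  then have EG: "star_le (std_mat E) (std_mat G)"
    using EF FG by (rule star_le_trans)
  have "has_dmpgi ((F - E) + (G - F))"
    using assms star_le_diff_orthogonal[OF EF FG EG]
    by (intro has_dmpgi_add) (simp_all add: dm_star_le_def std_mat_diff)
  then show ?thesis
    using EG by (simp add: dm_star_le_def)
qed

theorem theorem5p2:
  "partial_order_on {E :: dual ^ 'n ^ 'm. has_dmpgi E}
     (relation_of dm_star_le {E. has_dmpgi E})"
  by (rule partial_order_on_relation_ofI)
    (auto intro: dm_star_le_refl dm_star_le_antisym dm_star_le_trans)

end
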